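(* Let $\Gamma$ be a finite simple graph of order $n$ and minimum degree $\delta$, let $k$ be an integer, and suppose that $\Gamma$ is partitionable into global defensive $k$-alliances. Then (i) $\psi_{k}^{gd}(\Gamma) \le \left\lfloor\frac{\sqrt{k^2+4n}-k}{2}\right\rfloor$; (ii) $\psi_{k}^{gd}(\Gamma) \le \left\lfloor\frac{\delta-k+2}{2}\right\rfloor$.
   Context: Let $\Gamma=(V,E)$ be a finite simple graph of order $n=|V|$, with minimum degree $\delta$ and maximum degree $\Delta$. For $X\subseteq V$ and $v\in V$, $\delta_X(v)$ is the number of neighbors of $v$ in $X$; $\bar S=V\setminus S$. A nonempty set $S\subseteq V$ is a defensive $k$-alliance if $\delta_S(v)\ge\delta_{\bar S}(v)+k$ for every $v\in S$. It is a global defensive $k$-alliance if moreover it is a dominating set, i.e. $\delta_S(u)>0$ for every $u\in\bar S$. For an integer $k\in\{-\Delta,\dots,\delta\}$, $\psi_k^{gd}(\Gamma)$ is the maximum number of sets in a partition of $V$ such that each set is a global defensive $k$-alliance. $\Gamma$ is partitionable into global defensive $k$-alliances if $\psi_k^{gd}(\Gamma)\ge 2$. *)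

theory Defs
  imports Complex_Main "HOL-Library.Disjoint_Sets"
begin

definition finite_simple_graph :: "'a set \<Rightarrow> 'a set set \<Rightarrow> bool" where
  "finite_simple_graph V E \<longleftrightarrow> finite V \<and> (\<forall>e\<in>E. e \<subseteq> V \<and> card e = 2)"

definition deg_in :: "'a set set \<Rightarrow> 'a set \<Rightarrow> 'a \<Rightarrow> nat" where
  "deg_in E X v = card {u \<in> X. {u, v} \<in> E}"

definition min_degree :: "'a set \<Rightarrow> 'a set set \<Rightarrow> nat" where
  "min_degree V E = Min ((\<lambda>v. deg_in E V v) ` V)"

definition defensive_alliance :: "'a set \<Rightarrow> 'a set set \<Rightarrow> int \<Rightarrow> 'a set \<Rightarrow> bool" where
  "defensive_alliance V E k S \<longleftrightarrow>
     S \<noteq> {} \<and> S \<subseteq> V \<and> (\<forall>v\<in>S. int (deg_in E S v) \<ge> int (deg_in E (V - S) v) + k)"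

definition dominating_set :: "'a set \<Rightarrow> 'a set set \<Rightarrow> 'a set \<Rightarrow> bool" where
  "dominating_set V E S \<longleftrightarrow> S \<subseteq> V \<and> (\<forall>u\<in>V - S. deg_in E S u > 0)"

definition global_defensive_alliance :: "'a set \<Rightarrow> 'a set set \<Rightarrow> int \<Rightarrow> 'a set \<Rightarrow> bool" where
  "global_defensive_alliance V E k S \<longleftrightarrow>
     defensive_alliance V E k S \<and> dominating_set V E S"

text \<open>
  The supremum below is over a finite set of natural numbers, hence a maximum whenever that
  set is nonempty. For a nonempty graph it is nonempty exactly when \<open>k\<close> is at most the minimum
  degree, as then the one-block partition qualifies; otherwise the supremum is \<open>0\<close>.
\<close>

definition psi_gd :: "'a set \<Rightarrow> 'a set set \<Rightarrow> int \<Rightarrow> nat" where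
  "psi_gd V E k =
     Sup {card P | P. partition_on V P \<and> (\<forall>S\<in>P. global_defensive_alliance V E k S)}"

definition partitionable_gd :: "'a set \<Rightarrow> 'a set set \<Rightarrow> int \<Rightarrow> bool" where
  "partitionable_gd V E k \<longleftrightarrow> psi_gd V E k \<ge> 2"

end

theory Submission
  imports Defs
begin

text \<open>
  Let \<open>P\<close> be a partition into \<open>r\<close> global defensive \<open>k\<close>-alliances, and let \<open>v\<close> lie in the block
  \<open>S\<close>. Each of the other \<open>r - 1\<close> blocks dominates \<open>v\<close>, and these blocks are disjoint, so \<open>v\<close> has
  at least \<open>r - 1\<close> neighbours outside \<open>S\<close> (\<open>outside_degree_ge\<close>). The defensive condition turns
  this into at least \<open>r - 1 + k\<close> neighbours inside \<open>S\<close> (\<open>inside_degree_ge\<close>).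

  Both bounds follow by counting. A block contains \<open>v\<close> together with its neighbours in the block,
  hence has at least \<open>r + k\<close> elements; summing over the blocks gives \<open>r * (r + k) \<le> n\<close>,
  a quadratic inequality whose larger root is the bound in terms of the order
  (\<open>order_bound\<close>). Taking \<open>v\<close> of minimum degree and adding its degrees inside and outside its
  block gives \<open>2 * (r - 1) + k \<le> \<delta>\<close> (\<open>min_degree_bound\<close>). Both apply to \<open>psi_gd\<close> because the
  supremum defining it is attained by a partition (\<open>psi_gd_attained\<close>).
\<close>

lemma deg_in_Un_disjoint:
  assumes "finite A" "finite B" "A \<inter> B = {}"
  shows "deg_in E (A \<union> B) v = deg_in E A v + deg_in E B v"
proof -
  have "{u \<in> A \<union> B. {u, v} \<in> E} = {u \<in> A. {u, v} \<in> E} \<union> {u \<in> B. {u, v} \<in> E}"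
    by blast
  then show ?thesis
    unfolding deg_in_def using assms by (simp add: card_Un_disjoint disjoint_iff)
qed

lemma deg_in_Union_disjoint:
  assumes "finite Q" "\<And>T. T \<in> Q \<Longrightarrow> finite T" "disjoint Q"
  shows "deg_in E (\<Union>Q) v = (\<Sum>T\<in>Q. deg_in E T v)"
proof -
  have "{u \<in> \<Union>Q. {u, v} \<in> E} = (\<Union>T\<in>Q. {u \<in> T. {u, v} \<in> E})"
    by blast
  moreover have "card (\<Union>T\<in>Q. {u \<in> T. {u, v} \<in> E}) = (\<Sum>T\<in>Q. card {u \<in> T. {u, v} \<in> E})"
    using assms by (intro card_UN_disjoint) (auto simp: disjoint_def)
  ultimately show ?thesis
    by (simp add: deg_in_def)
qed

lemma deg_in_less_card:
  assumes "finite_simple_graph V E" "finite S" "v \<in> S"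
  shows "deg_in E S v < card S"
proof -
  \<comment> \<open>There are no loops: the edges have two elements.\<close>
  have "{v, v} \<notin> E"
    using assms(1) unfolding finite_simple_graph_def by fastforce
  then have "{u \<in> S. {u, v} \<in> E} \<subset> S"
    using assms(3) by blast
  then show ?thesis
    unfolding deg_in_def using assms(2) by (rule psubset_card_mono[rotated])
qed

text \<open>Every block other than \<open>S\<close> contributes a neighbour of \<open>v\<close>, since it dominates \<open>v\<close>.\<close>

lemma outside_degree_ge:
  assumes "finite V" "partition_on V P" "\<forall>T\<in>P. dominating_set V E T" "S \<in> P" "v \<in> S"
  shows "card P \<le> deg_in E (V - S) v + 1"
proof -
  have fP: "finite P"
    using assms(1,2) by (rule finite_elements)
  have disj: "disjoint P" and union: "\<Union>P = V"
    using assms(2) by (auto simp: partition_on_def)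
  have others: "V - S = \<Union>(P - {S})"
    using union disj assms(4) unfolding disjoint_def by blast
  have "card (P - {S}) = (\<Sum>T\<in>P - {S}. 1)"
    by simp
  also have "\<dots> \<le> (\<Sum>T\<in>P - {S}. deg_in E T v)"
  proof (rule sum_mono)
    fix T assume T: "T \<in> P - {S}"
    have "v \<in> V - T"
      using T disj union assms(4,5) unfolding disjoint_def by blast
    moreover have "dominating_set V E T"
      using T assms(3) by blast
    ultimately have "0 < deg_in E T v"
      by (simp only: dominating_set_def)
    then show "1 \<le> deg_in E T v"
      by simp
  qed
  also have "\<dots> = deg_in E (V - S) v"
    unfolding others
  proof (rule deg_in_Union_disjoint[symmetric])
    show "finite (P - {S})"
      using fP by simp
    show "finite T" if "T \<in> P - {S}" for T
      using that union assms(1) by (meson DiffD1 Union_upper finite_subset)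
    show "disjoint (P - {S})"
      using disj by (rule pairwise_subset) blast
  qed
  finally show ?thesis
    using fP assms(4) by simp
qed

lemma inside_degree_ge:
  assumes "finite V" "partition_on V P" "\<forall>T\<in>P. global_defensive_alliance V E k T"
    and "S \<in> P" "v \<in> S"
  shows "int (card P) - 1 + k \<le> int (deg_in E S v)"
proof -
  have "card P \<le> deg_in E (V - S) v + 1"
    using assms by (intro outside_degree_ge) (auto simp: global_defensive_alliance_def)
  moreover have "int (deg_in E (V - S) v) + k \<le> int (deg_in E S v)"
    using assms unfolding global_defensive_alliance_def defensive_alliance_def by blast
  ultimately show ?thesis
    by linarith
qed

lemma order_bound:
  assumes "finite_simple_graph V E" "partition_on V P"
    and "\<forall>S\<in>P. global_defensive_alliance V E k S"
  shows "int (card P) * (int (card P) + k) \<le> int (card V)"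
proof -
  have fV: "finite V"
    using assms(1) by (simp add: finite_simple_graph_def)
  have fin: "finite S" if "S \<in> P" for S
    using that assms(2) fV by (auto simp: partition_on_def intro: finite_subset)
  have block: "int (card P) + k \<le> int (card S)" if S: "S \<in> P" for S
  proof -
    obtain v where v: "v \<in> S"
      using partition_onD3[OF assms(2)] S by (cases "S = {}") auto
    show ?thesis
      using inside_degree_ge[OF fV assms(2,3) S v] deg_in_less_card[OF assms(1) fin[OF S] v]
      by linarith
  qed
  have "int (card P) * (int (card P) + k) = (\<Sum>S\<in>P. int (card P) + k)"
    by simp
  also have "\<dots> \<le> (\<Sum>S\<in>P. int (card S))"
    by (rule sum_mono) (rule block)
  also have "\<dots> = int (card V)"
    using product_partition[OF assms(2) fin] by simp
  finally show ?thesis .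
qed

lemma min_degree_bound:
  assumes "finite V" "V \<noteq> {}" "partition_on V P"
    and "\<forall>S\<in>P. global_defensive_alliance V E k S"
  shows "2 * (int (card P) - 1) + k \<le> int (min_degree V E)"
proof -
  have "min_degree V E \<in> (\<lambda>v. deg_in E V v) ` V"
    unfolding min_degree_def using assms(1,2) by (intro Min_in) auto
  then obtain v where v: "v \<in> V" "min_degree V E = deg_in E V v"
    by blast
  obtain S where S: "S \<in> P" "v \<in> S"
    using v(1) assms(3) by (auto simp: partition_on_def)
  have "S \<subseteq> V"
    using S(1) assms(3) by (auto simp: partition_on_def)
  then have "deg_in E V v = deg_in E S v + deg_in E (V - S) v"
    using deg_in_Un_disjoint[of S "V - S" E v] assms(1)
    by (simp add: finite_subset Un_absorb1)
  moreover have "card P \<le> deg_in E (V - S) v + 1"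
    using assms S by (intro outside_degree_ge) (auto simp: global_defensive_alliance_def)
  ultimately show ?thesis
    using inside_degree_ge[OF assms(1,3,4) S] unfolding v(2) by simp
qed

text \<open>
  A positive supremum cannot come from the empty set, and a finite set has only finitely many
  partitions, so the supremum is a maximum.
\<close>

lemma psi_gd_attained:
  assumes "finite V" "psi_gd V E k > 0"
  obtains P where "partition_on V P" "\<forall>S\<in>P. global_defensive_alliance V E k S"
    "psi_gd V E k = card P"
proof -
  let ?C = "{card P | P. partition_on V P \<and> (\<forall>S\<in>P. global_defensive_alliance V E k S)}"
  have "?C \<subseteq> card ` {P. partition_on V P}"
    by blast
  then have fin: "finite ?C"
    using finitely_many_partition_on[OF assms(1)] by (meson finite_imageI finite_subset)
  have "?C \<noteq> {}"
    using assms(2) unfolding psi_gd_def by (metis Sup_nat_empty less_irrefl)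
  then have "psi_gd V E k \<in> ?C"
    unfolding psi_gd_def using fin by (metis (no_types, lifting) Max_in cSup_eq_Max)
  then show thesis
    using that by blast
qed

text \<open>
  Completing the square in \<open>r * (r + k) \<le> n\<close> gives \<open>(2 * r + k)\<^sup>2 \<le> k\<^sup>2 + 4 * n\<close>; taking roots is
  sound whatever the sign of \<open>2 * r + k\<close>.
\<close>

lemma le_larger_root:
  fixes r k n :: real
  assumes "r * (r + k) \<le> n"
  shows "r \<le> (sqrt (k\<^sup>2 + 4 * n) - k) / 2"
proof -
  have "(2 * r + k)\<^sup>2 \<le> k\<^sup>2 + 4 * n"
    using assms by (simp add: power2_eq_square algebra_simps)
  then have "2 * r + k \<le> sqrt (k\<^sup>2 + 4 * n)"
    by (rule real_le_rsqrt)
  then show ?thesis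
    by simp
qed

theorem theorem2:
  fixes V :: "'a set" and E :: "'a set set" and n \<delta> :: nat and k :: int
  assumes "finite_simple_graph V E"
    and "n = card V"
    and "\<delta> = min_degree V E"
    and "partitionable_gd V E k"
  shows "int (psi_gd V E k) \<le> \<lfloor>(sqrt ((real_of_int k)\<^sup>2 + 4 * real n) - real_of_int k) / 2\<rfloor>
       \<and> int (psi_gd V E k) \<le> \<lfloor>(real \<delta> - real_of_int k + 2) / 2\<rfloor>"
proof -
  have fV: "finite V"
    using assms(1) by (simp add: finite_simple_graph_def)
  have pos: "psi_gd V E k > 0"
    using assms(4) by (simp add: partitionable_gd_def)
  obtain P where P: "partition_on V P" "\<forall>S\<in>P. global_defensive_alliance V E k S"
    and psi: "psi_gd V E k = card P"
    using psi_gd_attained[OF fV pos] .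
  \<comment> \<open>The empty graph has only the empty partition, whose cardinality is \<open>0\<close>.\<close>
  have "V \<noteq> {}"
    using P(1) psi pos by (auto simp: partition_on_empty)
  have "real_of_int (int (card P) * (int (card P) + k)) \<le> real_of_int (int n)"
    using order_bound[OF assms(1) P] assms(2) by (simp only: of_int_le_iff)
  then have "real (card P) \<le> (sqrt ((real_of_int k)\<^sup>2 + 4 * real n) - real_of_int k) / 2"
    by (intro le_larger_root) simp
  moreover have "real_of_int (2 * (int (card P) - 1) + k) \<le> real_of_int (int \<delta>)"
    using min_degree_bound[OF fV \<open>V \<noteq> {}\<close> P] assms(3) by (simp only: of_int_le_iff)
  then have "real (card P) \<le> (real \<delta> - real_of_int k + 2) / 2"
    by simp
  ultimately show ?thesis
    unfolding psi by (simp add: le_floor_iff)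
qed

end
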